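(* For every nonnegative integer $n$, $$a_{1,10}(10n+5)\equiv 0 \pmod 5.$$
   Context: Notation, for $|q|<1$: $(a;q)_\infty:=\prod_{k=0}^{\infty}(1-aq^k)$ and $(a_1,\ldots,a_k;q)_\infty:=(a_1;q)_\infty\cdots(a_k;q)_\infty$. For an integer $p\ge 2$ and an integer $1\le j\le p-1$ coprime to $p$, the numbers $a_{j,p}(n)$, $n\ge 0$, are the power series coefficients defined by $$\sum_{n=0}^\infty a_{j,p}(n)q^n=\frac{1}{(q^j,q^{p-j},q^p;q^p)_\infty}\sum_{n=-\infty}^\infty \frac{(-1)^nq^{pn(n+1)/2+jn+j}}{1-q^{pn+j}}.$$ Here the case $p=10$, $j=1$ is used. *)

theory Defs
  imports "HOL-Analysis.Analysis" "HOL-Number_Theory.Cong"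
begin

definition qpoch_inf :: "complex \<Rightarrow> complex \<Rightarrow> complex" where
  "qpoch_inf a q = (\<Prod>k. 1 - a * q ^ k)"

definition qpoch_inf_list :: "complex list \<Rightarrow> complex \<Rightarrow> complex" where
  "qpoch_inf_list as q = (\<Prod>a\<leftarrow>as. qpoch_inf a q)"

text \<open>
  The bilateral sum is an unordered sum over all integers; it converges absolutely for
  \<open>0 < |q| < 1\<close> and \<open>1 \<le> j < p\<close>.  The division by 2 is exact.
\<close>

definition gen_fun :: "nat \<Rightarrow> nat \<Rightarrow> complex \<Rightarrow> complex" where
  "gen_fun j p q =
     1 / qpoch_inf_list [q ^ j, q ^ (p - j), q ^ p] (q ^ p) *
     (\<Sum>\<^sub>\<infinity>n::int\<in>UNIV.
        (-1) powi n * q powi (int p * n * (n + 1) div 2 + int j * n + int j)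
          / (1 - q powi (int p * n + int j)))"

text \<open>
  The coefficients are characterised on the punctured unit disc: for negative \<open>n\<close> the summands
  contain negative powers of \<open>q\<close>, which HOL evaluates to 0 at \<open>q = 0\<close>, so that \<^const>\<open>gen_fun\<close> has
  the wrong value there (the singularity at 0 is removable).
\<close>

definition a_coeff :: "nat \<Rightarrow> nat \<Rightarrow> nat \<Rightarrow> int" where
  "a_coeff j p = (THE a. \<forall>q::complex. 0 < norm q \<and> norm q < 1 \<longrightarrow>
     (\<lambda>n. of_int (a n) * q ^ n) sums gen_fun j p q)"

end

theory Submission
  imports Defs "HOL-Complex_Analysis.Complex_Analysis"
begin

text \<open>
  Put \<open>Q = q^10\<close>, \<open>z = q\<close> and \<open>J = (Q;Q)\<close>. As a function of \<open>z\<close> with \<open>Q\<close> fixed, the Appell sum divided by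
  the theta product is invariant under \<open>z \<mapsto> zQ\<close> and \<open>z \<mapsto> 1/z\<close>, with a double pole at \<open>z = 1\<close>. After
  multiplication by \<open>J^3\<close> its principal part is that of the Lambert series
  \<open>\<wp>(z) = \<Sum> z Q^n / (1 - z Q^n)^2\<close> over all integers \<open>n\<close>, so the difference of the two is constant in \<open>z\<close>.
  Comparing \<open>z = q\<close> with \<open>z = -q\<close>, which share the same \<open>Q\<close>, shows that \<open>J^3\<close> times the generating
  function agrees with \<open>\<wp>(q)\<close> in all odd coefficients. The coefficient of \<open>q^N\<close> in \<open>\<wp>(q)\<close> is the
  sum of \<open>N/d\<close> over the divisors \<open>d \<equiv> 1, -1 (mod 10)\<close> of \<open>N\<close>, hence divisible by 5 when \<open>N\<close> is. Since \<open>J^3\<close>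
  is an integral power series in \<open>q^10\<close> with constant term 1, the congruence follows by induction.
\<close>

section \<open>One-sided Appell and Lambert sums\<close>

text \<open>
  For \<open>|Q| < |z| < 1\<close> the bilateral Appell sum is \<open>- appell_half z Q - appell_half (Q / z) Q\<close>, and the
  bilateral Lambert series is \<open>lambert_half z Q + lambert_half (Q / z) Q\<close>. Unlike the bilateral sums,
  these have no singularity at \<open>q = 0\<close> when \<open>z = q\<close> and \<open>Q = q^10\<close>.
\<close>

definition appell_half :: "complex \<Rightarrow> complex \<Rightarrow> complex" where
  "appell_half x Q = (\<Sum>m. (-1) ^ Suc m * Q ^ (m * (m + 1) div 2) * x ^ Suc m / (1 - x * Q ^ m))"

definition lambert_half :: "complex \<Rightarrow> complex \<Rightarrow> complex" where
  "lambert_half x Q = (\<Sum>m. x * Q ^ m / (1 - x * Q ^ m)\<^sup>2)"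

section \<open>Convergence of the sums and the product, uniformly on closed bidiscs\<close>

lemma one_minus_mult_power_bound:
  fixes x Q :: complex
  assumes "norm x \<le> r" "norm Q \<le> r" "r < 1"
  shows "norm (x * Q ^ m) \<le> r ^ Suc m" "1 - r \<le> norm (1 - x * Q ^ m)"
proof -
  have r: "0 \<le> r" using assms(1) norm_ge_zero order_trans by blast
  have "norm (x * Q ^ m) = norm x * norm Q ^ m" by (simp add: norm_mult norm_power)
  also have "\<dots> \<le> r * r ^ m" using assms r by (intro mult_mono power_mono) auto
  finally show *: "norm (x * Q ^ m) \<le> r ^ Suc m" by simp
  have "r ^ Suc m \<le> r" using power_decreasing[of 1 "Suc m" r] r assms by simp
  moreover have "1 - norm (x * Q ^ m) \<le> norm (1 - x * Q ^ m)"
    using norm_triangle_ineq2[of 1 "x * Q ^ m"] by simp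
  ultimately show "1 - r \<le> norm (1 - x * Q ^ m)" using * by linarith
qed

lemma one_minus_mult_power_nonzero:
  fixes x Q :: complex
  assumes "norm x < 1" "norm Q < 1"
  shows "1 - x * Q ^ m \<noteq> 0"
  using one_minus_mult_power_bound(2)[of x "max (norm x) (norm Q)" Q m] assms by auto

text \<open>The power of \<open>Q\<close> is estimated by 1 and the geometric decay is taken from
  \<open>x ^ Suc m\<close>. The majorant depends on \<open>r\<close> only, as the Weierstrass test
  requires.\<close>

lemma appell_half_term_bound:
  fixes x Q :: complex
  assumes "norm x \<le> r" "norm Q \<le> r" "r < 1"
  shows "norm ((-1) ^ Suc m * Q ^ (m * (m + 1) div 2) * x ^ Suc m / (1 - x * Q ^ m)) \<le> r ^ Suc m / (1 - r)"
proof -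
  have r: "0 \<le> r" using assms(1) norm_ge_zero order_trans by blast
  have "norm ((-1) ^ Suc m * Q ^ (m * (m + 1) div 2) * x ^ Suc m / (1 - x * Q ^ m))
     = norm Q ^ (m * (m + 1) div 2) * norm x ^ Suc m / norm (1 - x * Q ^ m)"
    by (simp add: norm_mult norm_power norm_divide)
  also have "\<dots> \<le> (1 * r ^ Suc m) / (1 - r)"
    using assms r one_minus_mult_power_bound(2)[OF assms, of m]
    by (intro frac_le mult_mono power_mono power_le_one) auto
  finally show ?thesis by simp
qed

lemma lambert_half_term_bound:
  fixes x Q :: complex
  assumes "norm x \<le> r" "norm Q \<le> r" "r < 1"
  shows "norm (x * Q ^ m / (1 - x * Q ^ m)\<^sup>2) \<le> r ^ Suc m / (1 - r)\<^sup>2"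
proof -
  have r: "0 \<le> r" using assms(1) norm_ge_zero order_trans by blast
  show ?thesis
    unfolding norm_divide norm_power[of _ 2]
    using assms r one_minus_mult_power_bound[OF assms, of m]
    by (intro frac_le power_mono) auto
qed

lemma summable_power_Suc_div:
  fixes r c :: real
  assumes "0 \<le> r" "r < 1"
  shows "summable (\<lambda>m. r ^ Suc m / c)"
  using assms by (intro summable_divide summable_Suc_iff[THEN iffD2] summable_geometric) auto

lemma
  fixes x Q :: complex
  assumes "norm x < 1" "norm Q < 1"
  shows appell_half_summable_norm:
      "summable (\<lambda>m. norm ((-1) ^ Suc m * Q ^ (m * (m + 1) div 2) * x ^ Suc m / (1 - x * Q ^ m)))"
    and lambert_half_summable: "summable (\<lambda>m. x * Q ^ m / (1 - x * Q ^ m)\<^sup>2)"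
proof -
  define r where "r = max (norm x) (norm Q)"
  have r: "0 \<le> r" "norm x \<le> r" "norm Q \<le> r" "r < 1" using assms by (auto simp: r_def le_max_iff_disj)
  show "summable (\<lambda>m. norm ((-1) ^ Suc m * Q ^ (m * (m + 1) div 2) * x ^ Suc m / (1 - x * Q ^ m)))"
    by (rule summable_comparison_test'[OF summable_power_Suc_div[OF r(1,4)]], unfold real_norm_def abs_norm_cancel)
       (rule appell_half_term_bound[OF r(2-4)])
  show "summable (\<lambda>m. x * Q ^ m / (1 - x * Q ^ m)\<^sup>2)"
    by (rule summable_comparison_test'[OF summable_power_Suc_div[OF r(1,4)]])
       (rule lambert_half_term_bound[OF r(2-4)])
qed

text \<open>Uniformity is joint in both arguments because they are used in two ways: with
  \<open>Q\<close> fixed and \<open>z\<close> moving in the elliptic identity, and with both equal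
  to powers of \<open>q\<close> in the coefficient arguments.\<close>

lemma appell_half_uniform_limit:
  assumes "0 \<le> r" "r < 1"
  shows "uniform_limit (cball 0 r \<times> cball 0 r)
     (\<lambda>N (x, Q). \<Sum>m<N. (-1) ^ Suc m * Q ^ (m * (m + 1) div 2) * x ^ Suc m / (1 - x * Q ^ m))
     (\<lambda>(x, Q). appell_half x Q) sequentially"
  unfolding appell_half_def case_prod_unfold
  by (rule Weierstrass_m_test[OF _ summable_power_Suc_div[OF assms]], rule appell_half_term_bound)
     (use assms in auto)

lemma lambert_half_uniform_limit:
  assumes "0 \<le> r" "r < 1"
  shows "uniform_limit (cball 0 r \<times> cball 0 r)
     (\<lambda>N (x, Q). \<Sum>m<N. x * Q ^ m / (1 - x * Q ^ m)\<^sup>2) (\<lambda>(x, Q). lambert_half x Q) sequentially"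
  unfolding lambert_half_def case_prod_unfold
  by (rule Weierstrass_m_test[OF _ summable_power_Suc_div[OF assms]], rule lambert_half_term_bound)
     (use assms in auto)

lemma convergent_qpoch_inf:
  fixes x Q :: complex
  assumes "norm Q < 1"
  shows "convergent_prod (\<lambda>k. 1 - x * Q ^ k)"
proof (rule abs_convergent_prod_imp_convergent_prod)
  have "summable (\<lambda>k. norm x * norm Q ^ k)"
    using assms by (intro summable_mult summable_geometric) auto
  then show "abs_convergent_prod (\<lambda>k. 1 - x * Q ^ k)"
    unfolding abs_convergent_prod_conv_summable by (simp add: norm_mult norm_power)
qed

lemma qpoch_inf_LIMSEQ:
  assumes "norm Q < 1"
  shows "(\<lambda>n. \<Prod>k<n. 1 - x * Q ^ k) \<longlonglongrightarrow> qpoch_inf x Q"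
  unfolding qpoch_inf_def using convergent_prod_LIMSEQ[OF convergent_qpoch_inf[OF assms], of x]
  by (simp add: LIMSEQ_lessThan_iff_atMost)

lemma qpoch_inf_nonzero:
  assumes "norm x < 1" "norm Q < 1"
  shows "qpoch_inf x Q \<noteq> 0"
  unfolding qpoch_inf_def
  using assms by (intro prodinf_nonzero convergent_qpoch_inf one_minus_mult_power_nonzero)

lemma qpoch_inf_uniform_limit:
  assumes "0 \<le> r" "r < 1"
  shows "uniform_limit (cball 0 r \<times> cball 0 r)
     (\<lambda>N (x, Q). \<Prod>m<N. 1 - x * Q ^ m) (\<lambda>(x, Q). qpoch_inf x Q) sequentially"
proof -
  let ?A = "cball 0 r \<times> cball 0 r :: (complex \<times> complex) set"
  have "uniformly_convergent_on ?A (\<lambda>N z. \<Prod>m<N. 1 - fst z * snd z ^ m)"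
  proof (rule uniformly_convergent_on_prod')
    show "uniformly_convergent_on ?A (\<lambda>N z. \<Sum>m<N. norm (1 - fst z * snd z ^ m - 1))"
    proof (rule Weierstrass_m_test')
      show "norm (norm (1 - fst z * snd z ^ n - 1)) \<le> r ^ Suc n / 1" if "z \<in> ?A" for n z
        using one_minus_mult_power_bound(1)[of "fst z" r "snd z" n] that assms by auto
      show "summable (\<lambda>n. r ^ Suc n / 1)"
        by (rule summable_power_Suc_div[OF assms])
    qed
  qed (auto intro!: continuous_intros compact_Times)
  then obtain l where l: "uniform_limit ?A (\<lambda>N z. \<Prod>m<N. 1 - fst z * snd z ^ m) l sequentially"
    unfolding uniformly_convergent_on_def by blast
  have "l z = qpoch_inf (fst z) (snd z)" if "z \<in> ?A" for z
    using tendsto_uniform_limitI[OF l that] qpoch_inf_LIMSEQ[of "snd z" "fst z"] that assms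
    by (intro LIMSEQ_unique) auto
  then have "uniform_limit ?A (\<lambda>N z. \<Prod>m<N. 1 - fst z * snd z ^ m) (\<lambda>z. qpoch_inf (fst z) (snd z)) sequentially"
    by (intro uniform_limit_cong'[THEN iffD1, OF _ _ l]) auto
  then show ?thesis by (simp add: case_prod_unfold)
qed

section \<open>Uniform limits and holomorphy along maps into the open bidisc\<close>

text \<open>On a compact set the norms of \<open>x\<close> and \<open>Q\<close> attain their maxima,
  which are below 1, so the image lies in a closed bidisc of some radius
  \<open>r < 1\<close>.\<close>

lemma uniform_limit_compose_disc_pair:
  fixes F :: "nat \<Rightarrow> complex \<times> complex \<Rightarrow> complex"
  assumes lim: "\<And>r. 0 \<le> r \<Longrightarrow> r < 1 \<Longrightarrow> uniform_limit (cball 0 r \<times> cball 0 r) F G sequentially"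
    and "compact K" "continuous_on K x" "continuous_on K Q"
    and "\<And>t. t \<in> K \<Longrightarrow> norm (x t) < 1" "\<And>t. t \<in> K \<Longrightarrow> norm (Q t) < 1"
  shows "uniform_limit K (\<lambda>N t. F N (x t, Q t)) (\<lambda>t. G (x t, Q t)) sequentially"
proof (cases "K = {}")
  case False
  have *: "\<exists>r. 0 \<le> r \<and> r < 1 \<and> (\<forall>t\<in>K. norm (g t) \<le> r)"
    if g: "continuous_on K g" "\<And>t. t \<in> K \<Longrightarrow> norm (g t) < 1" for g :: "'a \<Rightarrow> complex"
  proof -
    have "continuous_on K (\<lambda>t. norm (g t))" using g by (intro continuous_intros)
    from continuous_attains_sup[OF \<open>compact K\<close> False this] obtain t0
      where "t0 \<in> K" "\<forall>t\<in>K. norm (g t) \<le> norm (g t0)" by blast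
    then show ?thesis using g by (intro exI[of _ "norm (g t0)"]) auto
  qed
  obtain r1 where r1: "0 \<le> r1" "r1 < 1" "\<forall>t\<in>K. norm (x t) \<le> r1"
    using *[of x] assms by blast
  obtain r2 where r2: "0 \<le> r2" "r2 < 1" "\<forall>t\<in>K. norm (Q t) \<le> r2"
    using *[of Q] assms by blast
  show ?thesis
    by (rule uniform_limit_compose'[OF lim[of "max r1 r2"], where h = "\<lambda>t. (x t, Q t)"])
       (use r1 r2 in \<open>auto simp: le_max_iff_disj\<close>)
qed auto

lemma holomorphic_compose_disc_pair:
  fixes F :: "nat \<Rightarrow> complex \<times> complex \<Rightarrow> complex"
  assumes lim: "\<And>r. 0 \<le> r \<Longrightarrow> r < 1 \<Longrightarrow> uniform_limit (cball 0 r \<times> cball 0 r) F G sequentially"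
    and "open V" "x holomorphic_on V" "Q holomorphic_on V"
    and "\<And>t. t \<in> V \<Longrightarrow> norm (x t) < 1" "\<And>t. t \<in> V \<Longrightarrow> norm (Q t) < 1"
    and "\<And>N. (\<lambda>t. F N (x t, Q t)) holomorphic_on V"
  shows "(\<lambda>t. G (x t, Q t)) holomorphic_on V"
proof (rule holomorphic_uniform_sequence[OF \<open>open V\<close>])
  fix t assume "t \<in> V"
  then obtain d where d: "0 < d" "cball t d \<subseteq> V"
    using \<open>open V\<close> open_contains_cball by blast
  have "uniform_limit (cball t d) (\<lambda>N t. F N (x t, Q t)) (\<lambda>t. G (x t, Q t)) sequentially"
    using assms d
    by (intro uniform_limit_compose_disc_pair[OF lim])
       (auto intro!: holomorphic_on_imp_continuous_on intro: holomorphic_on_subset)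
  with d show "\<exists>d. 0 < d \<and> cball t d \<subseteq> V \<and>
     uniform_limit (cball t d) (\<lambda>N t. F N (x t, Q t)) (\<lambda>t. G (x t, Q t)) sequentially" by blast
qed (use assms in auto)

lemma
  assumes "open V" "x holomorphic_on V" "Q holomorphic_on V"
    and "\<And>t. t \<in> V \<Longrightarrow> norm (x t) < 1" "\<And>t. t \<in> V \<Longrightarrow> norm (Q t) < 1"
  shows holomorphic_on_appell_half: "(\<lambda>t. appell_half (x t) (Q t)) holomorphic_on V"
    and holomorphic_on_lambert_half: "(\<lambda>t. lambert_half (x t) (Q t)) holomorphic_on V"
    and holomorphic_on_qpoch_inf: "(\<lambda>t. qpoch_inf (x t) (Q t)) holomorphic_on V"
proof -
  have nz: "1 - x t * Q t ^ m \<noteq> 0" if "t \<in> V" for t m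
    using assms that one_minus_mult_power_nonzero by blast
  show "(\<lambda>t. appell_half (x t) (Q t)) holomorphic_on V"
    using holomorphic_compose_disc_pair[OF appell_half_uniform_limit assms] assms nz
    by (force intro!: holomorphic_intros simp del: power_Suc)
  show "(\<lambda>t. lambert_half (x t) (Q t)) holomorphic_on V"
    using holomorphic_compose_disc_pair[OF lambert_half_uniform_limit assms] assms nz
    by (force intro!: holomorphic_intros)
  show "(\<lambda>t. qpoch_inf (x t) (Q t)) holomorphic_on V"
    using holomorphic_compose_disc_pair[OF qpoch_inf_uniform_limit assms] assms
    by (force intro!: holomorphic_intros)
qed

section \<open>Functional equations under the shift from \<open>x\<close> to
  \<open>x * Q\<close>\<close>

lemma qpoch_inf_rec:
  assumes "norm x < 1" "norm Q < 1"
  shows "qpoch_inf x Q = (1 - x) * qpoch_inf (x * Q) Q"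
proof -
  have "1 - x * Q ^ 0 \<noteq> 0" using one_minus_mult_power_nonzero[OF assms] .
  from prodinf_split_head[OF convergent_qpoch_inf[OF assms(2), of x] this] this
  show ?thesis unfolding qpoch_inf_def by (simp add: mult_ac)
qed

lemma lambert_half_rec:
  assumes "norm x < 1" "norm Q < 1"
  shows "lambert_half x Q = x / (1 - x)\<^sup>2 + lambert_half (x * Q) Q"
  using suminf_split_head[OF lambert_half_summable[OF assms]]
  unfolding lambert_half_def by (simp add: mult_ac)

lemma triangular_Suc: "Suc m * (Suc m + 1) div 2 = m * (m + 1) div 2 + Suc m"
proof -
  have "Suc m * (Suc m + 1) = m * (m + 1) + Suc m * 2" by (simp add: algebra_simps)
  then show ?thesis by (metis div_mult_self1 zero_neq_numeral add.commute mult.commute)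
qed

text \<open>Since consecutive triangular numbers differ by \<open>Suc m\<close>, \<open>x\<close>
  times term \<open>m\<close> at \<open>x * Q\<close> is minus term \<open>Suc m\<close> at
  \<open>x\<close>; the correction \<open>x / (1 - x)\<close> is the split-off term 0. The left side
  makes sense beyond the unit circle, so the pole at 1 becomes explicit.\<close>

lemma appell_half_rec:
  assumes "norm x < 1" "norm Q < 1"
  shows "x * appell_half (x * Q) Q = - appell_half x Q - x / (1 - x)"
proof -
  let ?t = "\<lambda>x m. (-1) ^ Suc m * Q ^ (m * (m + 1) div 2) * x ^ Suc m / (1 - x * Q ^ m)"
  have sm: "summable (?t x)"
    using appell_half_summable_norm[OF assms] by (rule summable_norm_cancel)
  have "norm x * norm Q \<le> norm x * 1" using assms by (intro mult_left_mono) auto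
  then have "norm (x * Q) < 1" using assms by (simp add: norm_mult)
  then have sm': "summable (?t (x * Q))"
    by (rule summable_norm_cancel[OF appell_half_summable_norm[OF _ assms(2)]])
  have eq: "x * ?t (x * Q) m = - ?t x (Suc m)" for m
    unfolding triangular_Suc by (simp add: power_add power_mult_distrib mult_ac)
  have sm_Suc: "summable (\<lambda>m. ?t x (Suc m))"
    by (rule summable_Suc_iff[THEN iffD2, OF sm])
  have "x * appell_half (x * Q) Q = (\<Sum>m. x * ?t (x * Q) m)"
    unfolding appell_half_def by (rule suminf_mult[OF sm', symmetric])
  also have "\<dots> = - (\<Sum>m. ?t x (Suc m))"
    unfolding eq by (rule suminf_minus[OF sm_Suc])
  also have "(\<Sum>m. ?t x (Suc m)) = appell_half x Q - ?t x 0"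
    unfolding appell_half_def by (rule suminf_split_head[OF sm])
  finally show ?thesis by simp
qed

section \<open>The elliptic function identity\<close>

text \<open>Up to sign, \<open>h\<close> continues to a holomorphic function \<open>g\<close> on an
  annulus around the unit circle. Its symmetries under inversion and under
  \<open>z \<mapsto> Q / z\<close> force \<open>norm (g z)\<close> to attain its maximum inside the
  annulus, so the maximum modulus principle applies.\<close>

lemma appell_theta_constant:
  fixes Q z w :: complex
  defines "h \<equiv> \<lambda>z. (qpoch_inf Q Q)\<^sup>2 * (appell_half z Q + appell_half (Q / z) Q)
     / (qpoch_inf z Q * qpoch_inf (Q / z) Q) + lambert_half z Q + lambert_half (Q / z) Q"
  assumes z: "norm Q < norm z" "norm z < 1" and w: "norm Q < norm w" "norm w < 1" and "Q \<noteq> 0"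
  shows "h z = h w"
proof -
  \<comment> \<open>\<open>U\<close> is stable under inversion and is the region where both
    \<open>z * Q\<close> and \<open>Q / z\<close> lie in the unit disc. The form
    \<open>z - 0\<close> fits \<open>connected_annulus\<close>.\<close>
  define U where "U = {z::complex. norm Q < norm (z - 0) \<and> norm (z - 0) < 1 / norm Q}"
  have Q: "0 < norm Q" "norm Q < 1" using assms by auto
  \<comment> \<open>The recurrences split the factors \<open>1 - z\<close> off \<open>h\<close>: for
    \<open>norm Q < norm z\<close> and \<open>norm z < 1\<close>, \<open>M\<close> is
    \<open>- (1 - z)\<close> times the Appell sums, and \<open>- h z\<close> equals
    \<open>N z / (1 - z)^2 - P z\<close>. All singularity at 1 is thereby confined to the explicit
    denominator.\<close>
  define \<psi> where "\<psi> = (\<lambda>z. (qpoch_inf Q Q)\<^sup>2 / (qpoch_inf (z * Q) Q * qpoch_inf (Q / z) Q))"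
  define M where "M = (\<lambda>z. z + (1 - z) * (z * appell_half (z * Q) Q - appell_half (Q / z) Q))"
  define N where "N = (\<lambda>z. \<psi> z * M z - z)"
  define P where "P = (\<lambda>z. lambert_half (z * Q) Q + lambert_half (Q / z) Q)"
  have "U = {z. norm Q < norm z} \<inter> {z. norm z < 1 / norm Q}" by (auto simp: U_def)
  then have "open U" by (auto intro!: open_Int open_Collect_less continuous_intros)
  have "connected U" unfolding U_def by (intro connected_annulus) simp
  have U0: "z \<noteq> 0" and U1: "norm (z * Q) < 1" and U2: "norm (Q / z) < 1" and U3: "1 / z \<in> U"
    if "z \<in> U" for z
  proof -
    have z: "norm Q < norm z" "norm z * norm Q < 1" using that Q by (auto simp: U_def field_simps)
    then have "0 < norm z" using Q by linarith
    with z Q show "z \<noteq> 0" "norm (z * Q) < 1" "norm (Q / z) < 1" "1 / z \<in> U"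
      by (auto simp: U_def norm_mult norm_divide divide_simps mult.commute)
  qed
  have "1 < 1 / norm Q" using Q by simp
  then have in_U: "z \<in> U" if "norm Q < norm z" "norm z \<le> 1" for z
    using that by (auto simp: U_def)
  have one: "1 \<in> U" using Q by (intro in_U) auto
  have hol1: "(\<lambda>z. z * Q) holomorphic_on U" and hol2: "(\<lambda>z. Q / z) holomorphic_on U"
    and hol3: "(\<lambda>z. Q) holomorphic_on U"
    using U0 by (auto intro!: holomorphic_intros)
  note hols = holomorphic_on_appell_half[OF \<open>open U\<close> hol1 hol3 U1 Q(2)]
    holomorphic_on_appell_half[OF \<open>open U\<close> hol2 hol3 U2 Q(2)]
    holomorphic_on_lambert_half[OF \<open>open U\<close> hol1 hol3 U1 Q(2)]
    holomorphic_on_lambert_half[OF \<open>open U\<close> hol2 hol3 U2 Q(2)]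
    holomorphic_on_qpoch_inf[OF \<open>open U\<close> hol1 hol3 U1 Q(2)]
    holomorphic_on_qpoch_inf[OF \<open>open U\<close> hol2 hol3 U2 Q(2)]
  have Nhol: "N holomorphic_on U"
    unfolding N_def M_def \<psi>_def
    using U1 U2 Q qpoch_inf_nonzero by (auto intro!: holomorphic_intros hols)
  have Phol: "P holomorphic_on U"
    unfolding P_def by (intro holomorphic_intros hols)

  \<comment> \<open>Inversion swaps \<open>z * Q\<close> and \<open>Q / z\<close>, so
    \<open>\<psi>\<close> is invariant, while \<open>M\<close> and the subtracted \<open>z\<close>
    both acquire the factor \<open>1 / z^2\<close>.\<close>
  have N_inv: "N (1 / z) = N z / z\<^sup>2" if "z \<in> U" for z
  proof -
    have "\<psi> (1 / z) = \<psi> z" by (simp add: \<psi>_def mult.commute)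
    moreover have "M (1 / z) = M z / z\<^sup>2"
      using U0[OF that] by (simp add: M_def divide_simps mult.commute) (simp add: algebra_simps power2_eq_square)
    ultimately show ?thesis
      using U0[OF that] by (simp add: N_def field_simps power2_eq_square)
  qed
  have P_inv: "P (1 / z) = P z" for z
    by (simp add: P_def mult.commute)
  \<comment> \<open>This is where the normalisation by the square of \<open>qpoch_inf Q Q\<close>
    matters: it gives \<open>\<psi> 1 = 1\<close>, and \<open>M 1 = 1\<close>.\<close>
  have N1: "N 1 = 0"
    using qpoch_inf_nonzero[of Q Q] Q by (simp add: N_def M_def \<psi>_def power2_eq_square)
  txt \<open>Differentiating the symmetry \<open>N_inv\<close> at the fixed point 1 forces a double zero.\<close>
  have N'1: "deriv N 1 = 0"
  proof -
    have D: "(N has_field_derivative deriv N 1) (at 1)"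
      using holomorphic_derivI[OF Nhol \<open>open U\<close> one] .
    have "((\<lambda>z. N z / z\<^sup>2) has_field_derivative deriv N 1) (at 1)"
      by (rule derivative_eq_intros D refl | simp add: N1)+
    moreover have "((\<lambda>z. N (1 / z)) has_field_derivative deriv N 1 * (- 1)) (at 1)"
      by (rule DERIV_chain2[where f = N]) (auto intro!: derivative_eq_intros D)
    then have "((\<lambda>z. N z / z\<^sup>2) has_field_derivative deriv N 1 * (- 1)) (at 1)"
      by (rule has_field_derivative_transform_within_open[OF _ \<open>open U\<close> one]) (rule N_inv)
    ultimately have "deriv N 1 = deriv N 1 * (- 1)" by (rule DERIV_unique)
    then show ?thesis by simp
  qed
  \<comment> \<open>Two successive divided differences cancel the double zero of \<open>N\<close> at
    1, so that \<open>N z / (1 - z)^2\<close> extends holomorphically over 1 as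
    \<open>N2\<close>.\<close>
  define N1 where "N1 = (\<lambda>z. if z = 1 then deriv N 1 else (N z - N 1) / (z - 1))"
  define N2 where "N2 = (\<lambda>z. if z = 1 then deriv N1 1 else (N1 z - N1 1) / (z - 1))"
  have "N1 holomorphic_on U" unfolding N1_def by (rule pole_lemma_open[OF Nhol \<open>open U\<close>])
  then have N2hol: "N2 holomorphic_on U" unfolding N2_def by (rule pole_lemma_open[OF _ \<open>open U\<close>])
  have N2_eq: "N2 z = N z / (1 - z)\<^sup>2" if "z \<noteq> 1" for z
    using that N1 N'1 by (simp add: N2_def N1_def power2_eq_square) (simp add: algebra_simps)
  define g where "g = (\<lambda>z. N2 z - P z)"
  have ghol: "g holomorphic_on U" unfolding g_def by (intro holomorphic_intros N2hol Phol)
  have g_inv: "g (1 / z) = g z" if "z \<in> U" for z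
  proof (cases "z = 1")
    case False
    then have "1 - 1 / z \<noteq> 0" "1 / z \<noteq> 1" using U0[OF that] by auto
    then show ?thesis using False U0[OF that]
      unfolding g_def P_inv N2_eq[OF False] N2_eq[OF \<open>1 / z \<noteq> 1\<close>] N_inv[OF that]
      by (simp add: divide_simps) (simp add: algebra_simps power2_eq_square)
  qed auto
  have g_h: "g z = - h z" if z: "norm Q < norm z" "norm z < 1" for z
  proof -
    have zU: "z \<in> U" using z by (intro in_U) auto
    have z1: "z \<noteq> 1" "1 - z \<noteq> 0" using z by auto
    have a: "z * appell_half (z * Q) Q = - appell_half z Q - z / (1 - z)"
      by (rule appell_half_rec[OF z(2) Q(2)])
    have q: "qpoch_inf z Q = (1 - z) * qpoch_inf (z * Q) Q"
      by (rule qpoch_inf_rec[OF z(2) Q(2)])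
    have l: "lambert_half (z * Q) Q = lambert_half z Q - z / (1 - z)\<^sup>2"
      using lambert_half_rec[OF z(2) Q(2)] by simp
    have M: "M z = - (1 - z) * (appell_half z Q + appell_half (Q / z) Q)"
      unfolding M_def a using z1 by (simp add: field_simps)
    have nz: "qpoch_inf (z * Q) Q \<noteq> 0" "qpoch_inf (Q / z) Q \<noteq> 0"
      using qpoch_inf_nonzero U1[OF zU] U2[OF zU] Q by auto
    have "\<psi> z * M z / (1 - z)\<^sup>2 = - ((qpoch_inf Q Q)\<^sup>2 * (appell_half z Q + appell_half (Q / z) Q)
     / (qpoch_inf z Q * qpoch_inf (Q / z) Q))"
      unfolding M \<psi>_def q using nz z1 by (simp add: divide_simps power2_eq_square) (simp add: algebra_simps)
    then show ?thesis
      unfolding g_def N2_eq[OF z1(1)] P_def l h_def N_def by (simp add: diff_divide_distrib)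
  qed
  have h_inv: "h (Q / z) = h z" for z
    using \<open>Q \<noteq> 0\<close> by (simp add: h_def add_ac mult_ac)
  \<comment> \<open>This second symmetry is read off from \<open>h\<close>, whose formula is
    symmetric in \<open>z\<close> and \<open>Q / z\<close>; it is available where
    \<open>g = - h\<close>.\<close>
  have g_inv': "g (Q / z) = g z" if "norm Q < norm z" "norm z < 1" for z
  proof -
    have "0 < norm z" using that Q by linarith
    moreover have "norm Q * norm z < norm Q * 1" using that Q by (intro mult_strict_left_mono) auto
    ultimately have "norm Q < norm (Q / z)" "norm (Q / z) < 1"
      using that by (auto simp: norm_divide field_simps)
    then show ?thesis using g_h that h_inv by simp
  qed

  txt \<open>The two involutions move every point of \<open>U\<close> into the compact annulus \<open>K\<close>.\<close>
  define K where "K = {z::complex. sqrt (norm Q) \<le> norm z \<and> norm z \<le> 1}"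
  have sq: "norm Q < sqrt (norm Q)" "sqrt (norm Q) < 1" "0 < sqrt (norm Q)"
    using Q by (auto simp: real_less_rsqrt power2_eq_square)
  have KU: "K \<subseteq> U" using sq by (auto simp: K_def intro!: in_U)
  have "K = {z. sqrt (norm Q) \<le> norm z} \<inter> cball 0 1" by (auto simp: K_def)
  moreover have "closed {z::complex. sqrt (norm Q) \<le> norm z}"
    by (intro closed_Collect_le continuous_intros)
  ultimately have "compact K" by (auto intro: closed_Int_compact)
  have "1 \<in> K" using sq by (auto simp: K_def)
  have "continuous_on K (\<lambda>z. norm (g z))"
    by (intro continuous_intros holomorphic_on_imp_continuous_on holomorphic_on_subset[OF ghol KU])
  from continuous_attains_sup[OF \<open>compact K\<close> _ this] \<open>1 \<in> K\<close> obtain \<xi>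
    where \<xi>: "\<xi> \<in> K" "\<And>z. z \<in> K \<Longrightarrow> norm (g z) \<le> norm (g \<xi>)" by blast
  \<comment> \<open>The circle of radius \<open>sqrt (norm Q)\<close> is mapped to itself by
    \<open>z \<mapsto> Q / z\<close>, so points of \<open>U\<close> inside it go to points outside
    it of norm below 1, that is, into \<open>K\<close>.\<close>
  have le1: "norm (g z) \<le> norm (g \<xi>)" if "norm Q < norm z" "norm z \<le> 1" for z
  proof (cases "z \<in> K")
    case False
    then have "norm z < sqrt (norm Q)" using that by (auto simp: K_def)
    moreover have "norm Q = sqrt (norm Q) * sqrt (norm Q)" by simp
    ultimately have "sqrt (norm Q) * norm z \<le> norm Q"
      using sq by (metis mult_left_mono less_imp_le)
    moreover have "0 < norm z" using that Q by linarith
    ultimately have "Q / z \<in> K" using that Q by (auto simp: K_def norm_divide field_simps)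
    with \<xi>(2)[OF this] g_inv'[of z] that False show ?thesis
      using \<open>norm z < sqrt (norm Q)\<close> sq by auto
  qed (use \<xi> in auto)
  have "norm (g z) \<le> norm (g \<xi>)" if "z \<in> U" for z
  proof (cases "norm z \<le> 1")
    case False
    then have "norm (g (1 / z)) \<le> norm (g \<xi>)"
      using U3[OF that] by (intro le1) (auto simp: U_def norm_divide divide_le_eq_1)
    then show ?thesis using g_inv[OF that] by simp
  qed (use le1 that in \<open>auto simp: U_def\<close>)
  then have "g constant_on U"
    using maximum_modulus_principle[OF ghol \<open>open U\<close> \<open>connected U\<close> \<open>open U\<close> order_refl] \<xi>(1) KU by blast
  moreover have "z \<in> U" "w \<in> U"
    using z w by (auto intro!: in_U)
  ultimately have "g z = g w" by (auto simp: constant_on_def)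
  then show ?thesis using g_h z w by simp
qed

section \<open>Arithmetic of Taylor coefficients\<close>

text \<open>Higher derivatives at 0 commute with locally uniform limits of holomorphic functions,
  which lets coefficients be followed through infinite sums and products.\<close>

definition taylor_coeff :: "(complex \<Rightarrow> complex) \<Rightarrow> nat \<Rightarrow> complex" where
  "taylor_coeff f n = (deriv ^^ n) f 0 / fact n"

lemma taylor_coeff_eqI: "f has_fps_expansion F \<Longrightarrow> taylor_coeff f n = fps_nth F n"
  by (simp add: taylor_coeff_def fps_nth_fps_expansion)

lemma has_fps_expansion_taylor_coeff:
  "f holomorphic_on ball 0 1 \<Longrightarrow> f has_fps_expansion Abs_fps (taylor_coeff f)"
  unfolding taylor_coeff_def using has_fps_expansion_fps_expansion[of "ball 0 1" f]
  by (simp add: fps_expansion_def)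

lemma taylor_coeff_sums:
  "f holomorphic_on ball 0 1 \<Longrightarrow> norm q < 1 \<Longrightarrow> (\<lambda>n. taylor_coeff f n * q ^ n) sums f q"
  unfolding taylor_coeff_def using holomorphic_power_series[of f 0 1 q] by simp

lemma
  assumes "\<And>q. norm q < 1 \<Longrightarrow> (\<lambda>n. a n * q ^ n) sums f q"
  shows holomorphic_on_of_sums: "f holomorphic_on ball 0 1"
    and taylor_coeff_of_sums: "taylor_coeff f n = a n"
proof -
  show "f holomorphic_on ball 0 1"
    by (rule power_series_holomorphic[where a = a]) (use assms in auto)
  have "f has_fps_expansion Abs_fps a"
  proof (rule has_fps_expansionI)
    have "eventually (\<lambda>u::complex. u \<in> ball 0 1) (nhds 0)"
      by (intro eventually_nhds_in_open) auto
    then show "\<forall>\<^sub>F u in nhds 0. (\<lambda>n. fps_nth (Abs_fps a) n * u ^ n) sums f u"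
      by eventually_elim (use assms in auto)
  qed
  then show "taylor_coeff f n = a n" by (simp add: taylor_coeff_eqI)
qed

lemma taylor_coeff_mult:
  assumes "f holomorphic_on ball 0 1" "g holomorphic_on ball 0 1"
  shows "taylor_coeff (\<lambda>q. f q * g q) n = (\<Sum>i=0..n. taylor_coeff f i * taylor_coeff g (n - i))"
  using taylor_coeff_eqI[OF has_fps_expansion_mult[OF assms[THEN has_fps_expansion_taylor_coeff]]]
  by (simp add: fps_mult_nth)

lemma taylor_coeff_add:
  assumes "f holomorphic_on ball 0 1" "g holomorphic_on ball 0 1"
  shows "taylor_coeff (\<lambda>q. f q + g q) n = taylor_coeff f n + taylor_coeff g n"
  using taylor_coeff_eqI[OF has_fps_expansion_add[OF assms[THEN has_fps_expansion_taylor_coeff]]]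
  by simp

lemma taylor_coeff_diff:
  assumes "f holomorphic_on ball 0 1" "g holomorphic_on ball 0 1"
  shows "taylor_coeff (\<lambda>q. f q - g q) n = taylor_coeff f n - taylor_coeff g n"
  using taylor_coeff_eqI[OF has_fps_expansion_diff[OF assms[THEN has_fps_expansion_taylor_coeff]]]
  by simp

text \<open>Replacing \<open>q\<close> by \<open>- q\<close> multiplies the coefficient of index
  \<open>n\<close> by \<open>(-1) ^ n\<close>; uniqueness of the expansion then makes every odd
  coefficient its own negative.\<close>

lemma taylor_coeff_even_function:
  assumes "f holomorphic_on ball 0 1" "\<And>q. norm q < 1 \<Longrightarrow> f (- q) = f q" "odd n"
  shows "taylor_coeff f n = 0"
proof -
  have "(\<lambda>n. (- 1) ^ n * taylor_coeff f n * q ^ n) sums f q" if "norm q < 1" for q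
    using taylor_coeff_sums[OF assms(1), of "- q"] assms(2)[OF that] that
    by (simp add: power_minus[of q] mult_ac)
  from taylor_coeff_of_sums[OF this, of n] \<open>odd n\<close> show ?thesis by simp
qed

section \<open>A closure calculus for constraints on Taylor coefficients\<close>

text \<open>The admissible set varies with the exponent so that integrality, support on multiples of
  \<open>d\<close>, and divisibility by \<open>p\<close> at exponents divisible by \<open>p\<close>
  are all instances.\<close>

definition taylor_in :: "(nat \<Rightarrow> complex set) \<Rightarrow> (complex \<Rightarrow> complex) \<Rightarrow> bool" where
  "taylor_in X f \<longleftrightarrow> f holomorphic_on ball 0 1 \<and> (\<forall>n. taylor_coeff f n \<in> X n)"

lemma taylor_in_of_sums:
  assumes "\<And>q. norm q < 1 \<Longrightarrow> (\<lambda>n. a n * q ^ n) sums f q" "\<And>n. a n \<in> X n"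
  shows "taylor_in X f"
  unfolding taylor_in_def using holomorphic_on_of_sums[OF assms(1)] taylor_coeff_of_sums[OF assms(1)] assms(2)
  by simp

lemma taylor_in_monomial:
  assumes "c \<in> X k" "\<And>n. 0 \<in> X n"
  shows "taylor_in X (\<lambda>q. c * q ^ k)"
proof (rule taylor_in_of_sums)
  show "(\<lambda>n. (if n = k then c else 0) * q ^ n) sums (c * q ^ k)" for q :: complex
    using sums_single[of k "\<lambda>n. c * q ^ n"] by (simp add: if_distrib if_distribR cong: if_cong)
qed (use assms in auto)

lemma taylor_in_mult:
  assumes "taylor_in X f" "taylor_in X g" "\<And>n. 0 \<in> X n"
    and "\<And>n a b. a \<in> X n \<Longrightarrow> b \<in> X n \<Longrightarrow> a + b \<in> X n"
    and "\<And>m n a b. a \<in> X m \<Longrightarrow> b \<in> X n \<Longrightarrow> a * b \<in> X (m + n)"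
  shows "taylor_in X (\<lambda>q. f q * g q)"
proof -
  have sum_in: "(\<Sum>i\<in>I. t i) \<in> X n" if "finite I" "\<And>i. i \<in> I \<Longrightarrow> t i \<in> X n" for I and t :: "nat \<Rightarrow> complex" and n
    using that by (induction I) (auto intro: assms)
  have "taylor_coeff f i * taylor_coeff g (n - i) \<in> X n" if "i \<le> n" for i n
    using assms(5)[of "taylor_coeff f i" i "taylor_coeff g (n - i)" "n - i"] assms(1,2) that
    by (auto simp: taylor_in_def)
  then show ?thesis
    using assms(1,2) by (auto simp: taylor_in_def taylor_coeff_mult intro!: sum_in holomorphic_on_mult)
qed

lemma taylor_in_add:
  assumes "taylor_in X f" "taylor_in X g"
    and "\<And>n a b. a \<in> X n \<Longrightarrow> b \<in> X n \<Longrightarrow> a + b \<in> X n"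
  shows "taylor_in X (\<lambda>q. f q + g q)"
  using assms by (auto simp: taylor_in_def taylor_coeff_add intro!: holomorphic_on_add)

lemma taylor_in_sum:
  assumes "\<And>i. i \<in> I \<Longrightarrow> taylor_in X (f i)" "finite I" "\<And>n. 0 \<in> X n"
    and "\<And>n a b. a \<in> X n \<Longrightarrow> b \<in> X n \<Longrightarrow> a + b \<in> X n"
  shows "taylor_in X (\<lambda>q. \<Sum>i\<in>I. f i q)"
  using assms(2,1)
proof (induction I)
  case empty
  then show ?case using taylor_in_monomial[of 0 X 0] assms(3) by simp
next
  case (insert i I)
  then show ?case by (simp add: taylor_in_add assms(4))
qed

lemma taylor_in_prod:
  assumes "\<And>i. i \<in> I \<Longrightarrow> taylor_in X (f i)" "finite I" "\<And>n. 0 \<in> X n" "1 \<in> X 0"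
    and "\<And>n a b. a \<in> X n \<Longrightarrow> b \<in> X n \<Longrightarrow> a + b \<in> X n"
    and "\<And>m n a b. a \<in> X m \<Longrightarrow> b \<in> X n \<Longrightarrow> a * b \<in> X (m + n)"
  shows "taylor_in X (\<lambda>q. \<Prod>i\<in>I. f i q)"
  using assms(2,1)
proof (induction I)
  case empty
  then show ?case using taylor_in_monomial[of 1 X 0] assms(3,4) by simp
next
  case (insert i I)
  then have "taylor_in X (\<lambda>q. f i q * (\<Prod>i\<in>I. f i q))"
    using assms(3,5,6) by (intro taylor_in_mult) auto
  then show ?case using insert by simp
qed

text \<open>Uniform convergence near 0 makes each Taylor coefficient converge, and closedness of
  \<open>X n\<close> keeps the limit in it. For sets of integers this closedness comes from
  discreteness.\<close>

lemma taylor_in_compose_disc_pair: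
  fixes F :: "nat \<Rightarrow> complex \<times> complex \<Rightarrow> complex"
  assumes lim: "\<And>r. 0 \<le> r \<Longrightarrow> r < 1 \<Longrightarrow> uniform_limit (cball 0 r \<times> cball 0 r) F G sequentially"
    and x: "x holomorphic_on ball 0 1" "\<And>q. norm q < 1 \<Longrightarrow> norm (x q) < 1"
    and Q: "Q holomorphic_on ball 0 1" "\<And>q. norm q < 1 \<Longrightarrow> norm (Q q) < 1"
    and X: "\<And>N. taylor_in X (\<lambda>q. F N (x q, Q q))" "\<And>n. closed (X n)"
  shows "taylor_in X (\<lambda>q. G (x q, Q q))"
  unfolding taylor_in_def
proof (intro conjI allI)
  have hol: "(\<lambda>q. F N (x q, Q q)) holomorphic_on ball 0 1" for N
    using X(1) by (auto simp: taylor_in_def)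
  show "(\<lambda>q. G (x q, Q q)) holomorphic_on ball 0 1"
    by (rule holomorphic_compose_disc_pair[OF lim]) (use x Q hol in auto)
  fix n
  have "cball 0 (1/2) \<subseteq> ball (0::complex) 1" by auto
  then have "uniform_limit (cball 0 (1/2)) (\<lambda>N q. F N (x q, Q q)) (\<lambda>q. G (x q, Q q)) sequentially"
    using x Q
    by (intro uniform_limit_compose_disc_pair[OF lim])
       (auto intro!: holomorphic_on_imp_continuous_on elim: holomorphic_on_subset)
  then have "uniform_limit (ball 0 (1/2)) (\<lambda>N q. F N (x q, Q q)) (\<lambda>q. G (x q, Q q)) sequentially"
    by (rule uniform_limit_on_subset) auto
  then have "(\<lambda>N. (deriv ^^ n) (\<lambda>q. F N (x q, Q q)) 0) \<longlonglongrightarrow> (deriv ^^ n) (\<lambda>q. G (x q, Q q)) 0"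
    by (rule higher_deriv_complex_uniform_limit)
       (auto intro!: always_eventually holomorphic_on_subset[OF hol])
  then have "(\<lambda>N. taylor_coeff (\<lambda>q. F N (x q, Q q)) n) \<longlonglongrightarrow> taylor_coeff (\<lambda>q. G (x q, Q q)) n"
    unfolding taylor_coeff_def by (intro tendsto_divide) auto
  then show "taylor_coeff (\<lambda>q. G (x q, Q q)) n \<in> X n"
    by (rule Lim_in_closed_set[OF X(2), rotated 2]) (use X(1) in \<open>auto simp: taylor_in_def\<close>)
qed

text \<open>The constant term 1 of \<open>D\<close> lets the Cauchy product be solved for the top
  coefficient of \<open>A\<close> without division, so integrality follows by strong
  induction.\<close>

lemma taylor_in_Ints_divide:
  assumes D: "taylor_in (\<lambda>_. \<int>) D" "D 0 = 1" and S: "taylor_in (\<lambda>_. \<int>) S"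
    and A: "A holomorphic_on ball 0 1" "\<And>q. norm q < 1 \<Longrightarrow> D q * A q = S q"
  shows "taylor_in (\<lambda>_. \<int>) A"
  unfolding taylor_in_def
proof (intro conjI allI A)
  have hol: "D holomorphic_on ball 0 1" and DS: "taylor_coeff D i \<in> \<int>" "taylor_coeff S i \<in> \<int>" for i
    using D S by (auto simp: taylor_in_def)
  have sums: "(\<lambda>n. taylor_coeff (\<lambda>q. D q * A q) n * q ^ n) sums S q" if "norm q < 1" for q
    using taylor_coeff_sums[OF holomorphic_on_mult[OF hol A(1)] that] A(2)[OF that] by simp
  fix n
  show "taylor_coeff A n \<in> \<int>"
  proof (induction n rule: less_induct)
    case (less n)
    have "taylor_coeff S n = (\<Sum>i=0..n. taylor_coeff D i * taylor_coeff A (n - i))"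
      using taylor_coeff_of_sums[OF sums, of n] taylor_coeff_mult[OF hol A(1)] by simp
    also have "\<dots> = taylor_coeff A n + (\<Sum>i=1..n. taylor_coeff D i * taylor_coeff A (n - i))"
      using D(2) by (subst sum.atLeast_Suc_atMost) (auto simp: taylor_coeff_def)
    finally have "taylor_coeff A n = taylor_coeff S n - (\<Sum>i=1..n. taylor_coeff D i * taylor_coeff A (n - i))"
      by simp
    also have "\<dots> \<in> \<int>"
      using less DS by (intro Ints_diff Ints_sum Ints_mult) auto
    finally show ?case .
  qed
qed

section \<open>Integrality and divisibility for the coefficients of the concrete series\<close>

lemma of_int_image_add:
  assumes "x \<in> of_int ` A" "y \<in> of_int ` B" "\<And>i j. i \<in> A \<Longrightarrow> j \<in> B \<Longrightarrow> i + j \<in> C"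
  shows "x + y \<in> of_int ` C"
  using assms by (elim imageE) (metis imageI of_int_add)

lemma of_int_image_mult:
  assumes "x \<in> of_int ` A" "y \<in> of_int ` B" "\<And>i j. i \<in> A \<Longrightarrow> j \<in> B \<Longrightarrow> i * j \<in> C"
  shows "x * y \<in> of_int ` C"
  using assms by (elim imageE) (metis imageI of_int_mult)

lemma norm_power_less_one:
  fixes q :: "'a::real_normed_div_algebra"
  assumes "norm q < 1" "0 < a"
  shows "norm (q ^ a) < 1"
  using assms by (simp add: norm_power power_less_one_iff)

lemma sums_dvd_reindex:
  fixes q :: "'a::real_normed_field"
  assumes "(\<lambda>n. a n * (q ^ l) ^ n) sums s" "0 < l"
  shows "(\<lambda>n. (if l dvd n then a (n div l) else 0) * q ^ n) sums s"
proof -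
  have "strict_mono (\<lambda>n. l * n)" using \<open>0 < l\<close> by (simp add: strict_mono_def)
  then have "(\<lambda>n. (if l dvd l * n then a (l * n div l) else 0) * q ^ (l * n)) sums s
     \<longleftrightarrow> (\<lambda>n. (if l dvd n then a (n div l) else 0) * q ^ n) sums s"
    by (rule sums_mono_reindex) auto
  then show ?thesis using assms by (simp add: power_mult)
qed

lemma taylor_in_geometric:
  assumes "0 < l"
  shows "taylor_in (\<lambda>_. \<int>) (\<lambda>q. 1 / (1 - q ^ l))"
proof (rule taylor_in_of_sums)
  show "(\<lambda>n. (if l dvd n then 1 else 0) * q ^ n) sums (1 / (1 - q ^ l))"
    if "norm q < 1" for q :: complex
    using sums_dvd_reindex[of "\<lambda>_. 1", OF _ assms] geometric_sums[OF norm_power_less_one[OF that assms]]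
    by simp
qed auto

lemma nat_power_sums:
  fixes x :: "'a::{real_normed_field,banach}"
  assumes "norm x < 1"
  shows "(\<lambda>n. of_nat n * x ^ n) sums (x / (1 - x)\<^sup>2)"
proof -
  have "(\<lambda>n. x * (of_nat (Suc n) * x ^ n)) sums (x * (1 / (1 - x)\<^sup>2))"
    by (rule sums_mult[OF geometric_deriv_sums[OF assms]])
  then have "(\<lambda>n. of_nat (Suc n) * x ^ Suc n) sums (x / (1 - x)\<^sup>2)"
    by (simp add: mult_ac)
  from sums_Suc_iff[THEN iffD1, OF this] show ?thesis by simp
qed

text \<open>The coefficient at a multiple \<open>n\<close> of \<open>l\<close> is
  \<open>n div l\<close>, and coprimality of \<open>l\<close> and \<open>p\<close> carries
  divisibility by \<open>p\<close> from \<open>n\<close> to \<open>n div l\<close>.\<close>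

lemma taylor_in_lambert_term:
  assumes "0 < l" "coprime (l::nat) p"
  shows "taylor_in (\<lambda>n. of_int ` {k. p dvd n \<longrightarrow> int p dvd k}) (\<lambda>q. q ^ l / (1 - q ^ l)\<^sup>2)"
proof (rule taylor_in_of_sums)
  show "(\<lambda>n. (if l dvd n then of_nat (n div l) else 0) * q ^ n) sums (q ^ l / (1 - q ^ l)\<^sup>2)"
    if "norm q < 1" for q :: complex
    by (intro sums_dvd_reindex nat_power_sums norm_power_less_one that assms)
  fix n
  have "(if l dvd n then of_nat (n div l) else 0) = (of_int (if l dvd n then int (n div l) else 0) :: complex)"
    by simp
  moreover have "p dvd n div l" if "l dvd n" "p dvd n"
    using that assms by (metis coprime_commute coprime_dvd_mult_right_iff dvd_mult_div_cancel)
  then have "(if l dvd n then int (n div l) else 0) \<in> {k. p dvd n \<longrightarrow> int p dvd k}"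
    by auto
  ultimately show "(if l dvd n then of_nat (n div l) else 0) \<in> (of_int ` {k. p dvd n \<longrightarrow> int p dvd k} :: complex set)"
    by (rule image_eqI)
qed

lemma taylor_in_lambert_half:
  assumes "0 < a" "0 < b" "\<And>m. coprime (a + b * m) p"
  shows "taylor_in (\<lambda>n. of_int ` {k. p dvd n \<longrightarrow> int p dvd k}) (\<lambda>q. lambert_half (q ^ a) (q ^ b))"
    (is "taylor_in ?X _")
proof -
  have "taylor_in ?X (\<lambda>q. case (q ^ a, q ^ b) of (x, Q) \<Rightarrow> lambert_half x Q)"
  proof (rule taylor_in_compose_disc_pair[OF lambert_half_uniform_limit])
    fix N
    have "taylor_in ?X (\<lambda>q. \<Sum>m<N. q ^ (a + b * m) / (1 - q ^ (a + b * m))\<^sup>2)"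
    proof (intro taylor_in_sum taylor_in_lambert_term assms)
      show "x + y \<in> ?X n" if "x \<in> ?X n" "y \<in> ?X n" for x y :: complex and n
        using that by (rule of_int_image_add) auto
    qed (use \<open>0 < a\<close> in auto)
    then show "taylor_in ?X (\<lambda>q. case (q ^ a, q ^ b) of (x, Q) \<Rightarrow> \<Sum>m<N. x * Q ^ m / (1 - x * Q ^ m)\<^sup>2)"
      by (simp add: power_add power_mult)
  qed (auto intro!: holomorphic_intros norm_power_less_one assms closed_of_int_image)
  then show ?thesis by simp
qed

lemma taylor_in_appell_half:
  assumes "0 < a" "0 < b"
  shows "taylor_in (\<lambda>_. \<int>) (\<lambda>q. appell_half (q ^ a) (q ^ b))"
proof -
  have "taylor_in (\<lambda>_. \<int>) (\<lambda>q. case (q ^ a, q ^ b) of (x, Q) \<Rightarrow> appell_half x Q)"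
  proof (rule taylor_in_compose_disc_pair[OF appell_half_uniform_limit])
    fix N
    \<comment> \<open>Each term is a signed monomial times a geometric series, since
      \<open>x * Q ^ m\<close> is \<open>q ^ (a + b * m)\<close>.\<close>
    have "taylor_in (\<lambda>_. \<int>)
       (\<lambda>q. \<Sum>m<N. ((-1) ^ Suc m * q ^ (b * (m * (m + 1) div 2) + a * Suc m)) * (1 / (1 - q ^ (a + b * m))))"
      by (intro taylor_in_sum taylor_in_mult taylor_in_monomial taylor_in_geometric)
         (use \<open>0 < a\<close> in auto)
    moreover have "(\<Sum>m<N. ((-1) ^ Suc m * q ^ (b * (m * (m + 1) div 2) + a * Suc m)) * (1 / (1 - q ^ (a + b * m))))
       = (case (q ^ a, q ^ b) of (x, Q) \<Rightarrow> \<Sum>m<N. (-1) ^ Suc m * Q ^ (m * (m + 1) div 2) * x ^ Suc m / (1 - x * Q ^ m))"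
      for q :: complex
      unfolding prod.case power_add power_mult by (intro sum.cong refl) (simp only: times_divide_eq_right mult_1_right mult.assoc)
    ultimately show "taylor_in (\<lambda>_. \<int>) (\<lambda>q. case (q ^ a, q ^ b) of (x, Q) \<Rightarrow>
       \<Sum>m<N. (-1) ^ Suc m * Q ^ (m * (m + 1) div 2) * x ^ Suc m / (1 - x * Q ^ m))"
      by simp
  qed (auto intro!: holomorphic_intros norm_power_less_one assms simp: Ints_def closed_of_int_image)
  then show ?thesis by simp
qed

text \<open>The set allows any integer at multiples of \<open>d\<close> and only 0 elsewhere. The
  case \<open>d = 1\<close> gives plain integrality; \<open>d = 10\<close> will express that a
  product is a series in \<open>q ^ 10\<close>.\<close>

lemma taylor_in_qpoch_inf:
  assumes "0 < a" "0 < b" "\<And>m. d dvd a + b * m"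
  shows "taylor_in (\<lambda>n. of_int ` {k. d dvd n \<or> k = 0}) (\<lambda>q. qpoch_inf (q ^ a) (q ^ b))"
    (is "taylor_in ?X _")
proof -
  have add: "x + y \<in> ?X n" if "x \<in> ?X n" "y \<in> ?X n" for x y :: complex and n
    using that by (rule of_int_image_add) auto
  have mult: "x * y \<in> ?X (m + n)" if "x \<in> ?X m" "y \<in> ?X n" for x y :: complex and m n
    using that by (rule of_int_image_mult) auto
  have zero: "0 \<in> ?X n" for n by auto
  have one: "c \<in> ?X n" if "d dvd n" "c \<in> \<int>" for c :: complex and n
    using that by (auto simp: Ints_def)
  have "taylor_in ?X (\<lambda>q. case (q ^ a, q ^ b) of (x, Q) \<Rightarrow> qpoch_inf x Q)"
  proof (rule taylor_in_compose_disc_pair[OF qpoch_inf_uniform_limit])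
    fix N
    have "taylor_in ?X (\<lambda>q. 1 * q ^ 0 + (- 1) * q ^ (a + b * m))" for m
      by (rule taylor_in_add[OF taylor_in_monomial[OF one zero] taylor_in_monomial[OF one zero] add])
         (use assms(3) in auto)
    then have "taylor_in ?X (\<lambda>q. \<Prod>m<N. 1 * q ^ 0 + (- 1) * q ^ (a + b * m))"
    proof (rule taylor_in_prod)
      show "1 \<in> ?X 0" by (rule one) auto
    qed (fact zero add mult | simp)+
    then show "taylor_in ?X (\<lambda>q. case (q ^ a, q ^ b) of (x, Q) \<Rightarrow> \<Prod>m<N. 1 - x * Q ^ m)"
      by (simp add: power_add power_mult)
  qed (auto intro!: holomorphic_intros norm_power_less_one assms closed_of_int_image)
  then show ?thesis by simp
qed

section \<open>From the bilateral sum and the definite description to one-sided series\<close>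

lemma infsum_int_split:
  fixes f :: "int \<Rightarrow> 'a::banach"
  assumes "summable (\<lambda>k. norm (f (int k)))" "summable (\<lambda>k. norm (f (- int k - 1)))"
  shows "infsum f UNIV = (\<Sum>k. f (int k)) + (\<Sum>k. f (- int k - 1))"
proof -
  define g where "g = (\<lambda>k. - int k - 1)"
  have sums: "((\<lambda>k. h k) has_sum suminf h) UNIV" if "summable (\<lambda>k. norm (h k))" for h :: "nat \<Rightarrow> 'a"
    by (rule norm_summable_imp_has_sum[OF that summable_sums[OF summable_norm_cancel[OF that]]])
  have g: "inj g" by (auto simp: g_def inj_on_def)
  have "(f has_sum (\<Sum>k. f (int k))) (range int)"
    using sums[OF assms(1)] by (simp add: has_sum_reindex o_def)
  moreover have "(f has_sum (\<Sum>k. f (g k))) (range g)"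
    using sums[OF assms(2)] g by (simp add: has_sum_reindex o_def g_def)
  moreover have "range int \<inter> range g = {}" by (auto simp: g_def)
  ultimately have "(f has_sum ((\<Sum>k. f (int k)) + (\<Sum>k. f (g k)))) (range int \<union> range g)"
    by (rule has_sum_Un_disjoint)
  moreover have "range int \<union> range g = UNIV"
  proof -
    have "n \<in> range int \<union> range g" for n
    proof (cases "0 \<le> n")
      case True
      then have "n = int (nat n)" by simp
      then show ?thesis by blast
    next
      case False
      then have "n = g (nat (- n - 1))" by (simp add: g_def)
      then show ?thesis by blast
    qed
    then show ?thesis by blast
  qed
  ultimately show ?thesis by (simp add: infsumI g_def)
qed

text \<open>The terms with \<open>n \<ge> 0\<close> form \<open>- appell_half q (q ^ 10)\<close>,
  and those with \<open>n = - k - 1\<close> form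
  \<open>- appell_half (q ^ 9) (q ^ 10)\<close>.\<close>

lemma gen_fun_1_10:
  assumes "q \<noteq> 0" "norm q < 1"
  shows "gen_fun 1 10 q = - (appell_half q (q ^ 10) + appell_half (q ^ 9) (q ^ 10))
     / (qpoch_inf q (q ^ 10) * qpoch_inf (q ^ 9) (q ^ 10) * qpoch_inf (q ^ 10) (q ^ 10))"
proof -
  define f where "f = (\<lambda>n::int. (-1) powi n * q powi (int 10 * n * (n + 1) div 2 + int 1 * n + int 1)
     / (1 - q powi (int 10 * n + int 1)))"
  define t where "t = (\<lambda>x k. (-1) ^ Suc k * (q ^ 10) ^ (k * (k + 1) div 2) * x ^ Suc k / (1 - x * (q ^ 10) ^ k))"
  have T: "10 * (k * (k + 1) div 2) = 5 * k * (k + 1)" for k :: nat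
  proof -
    have "even (k * (k + 1))" by simp
    then have "2 * (k * (k + 1) div 2) = k * (k + 1)" by (rule dvd_mult_div_cancel)
    moreover have "10 * y = 5 * (2 * y)" for y :: nat by simp
    ultimately show ?thesis by (metis mult.assoc)
  qed
  have t1: "t q k = - f (int k)" for k
  proof -
    have e: "int 10 * int k * (int k + 1) div 2 + int 1 * int k + int 1 = int (5 * k * (k + 1) + Suc k)"
      by (simp add: algebra_simps)
    have e': "int 10 * int k + int 1 = int (10 * k + 1)" by simp
    show ?thesis
      unfolding t_def f_def e e' power_int_of_nat power_mult[symmetric] T
      by (simp add: power_add mult_ac)
  qed
  have t2: "t (q ^ 9) k = - f (- int k - 1)" for k
  proof -
    have "int 10 * (- int k - 1) * (- int k - 1 + 1) div 2 + int 1 * (- int k - 1) + int 1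
       = int (5 * k * (k + 1)) - int k"
      by (simp add: algebra_simps)
    then have e: "q powi (int 10 * (- int k - 1) * (- int k - 1 + 1) div 2 + int 1 * (- int k - 1) + int 1)
       = q ^ (5 * k * (k + 1)) / q ^ k"
      by (simp only: power_int_diff[OF disjI1[OF \<open>q \<noteq> 0\<close>]] power_int_of_nat)
    have "int 10 * (- int k - 1) + int 1 = - int (10 * k + 9)" by simp
    then have e': "q powi (int 10 * (- int k - 1) + int 1) = 1 / q ^ (10 * k + 9)"
      by (simp only: power_int_minus power_int_of_nat inverse_eq_divide)
    have "- int k - 1 = - int (Suc k)" by simp
    then have "(- 1) powi (- int k - 1) = (-1::complex) powi (- int (Suc k))" by (simp only:)
    also have "\<dots> = (- 1) ^ Suc k"
      by (simp only: power_int_minus power_int_of_nat power_inverse[symmetric]) simp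
    finally have e'': "(- 1) powi (- int k - 1) = (-1::complex) ^ Suc k" .
    have nz: "1 - q ^ (10 * k + 9) \<noteq> 0"
      using norm_power_less_one[OF assms(2), of "10 * k + 9"] by auto
    have "t (q ^ 9) k = (- 1) ^ Suc k * q ^ (5 * k * (k + 1)) * q ^ (9 * Suc k) / (1 - q ^ (10 * k + 9))"
      unfolding t_def power_mult[symmetric] T by (simp add: power_add mult_ac)
    \<comment> \<open>Multiplying numerator and denominator by \<open>q ^ (10 * k + 9)\<close>
      clears the negative powers; the reversed denominator accounts for the sign.\<close>
    also have "\<dots> = - ((- 1) ^ Suc k * (q ^ (5 * k * (k + 1)) / q ^ k) / (1 - 1 / q ^ (10 * k + 9)))"
    proof -
      have "q ^ (10 * k + 9) = q ^ k * q ^ (9 * Suc k)" by (simp flip: power_add)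
      then show ?thesis using \<open>q \<noteq> 0\<close> nz by (simp add: divide_simps) (simp add: algebra_simps)
    qed
    finally show ?thesis unfolding f_def e e' e'' .
  qed
  have "norm (q ^ 10) < 1" "norm (q ^ 9) < 1"
    using assms by (auto intro: norm_power_less_one simp del: norm_power)
  with assms have "summable (\<lambda>k. norm (t q k))" "summable (\<lambda>k. norm (t (q ^ 9) k))"
    unfolding t_def by (blast intro: appell_half_summable_norm)+
  then have s: "summable (\<lambda>k. norm (f (int k)))" "summable (\<lambda>k. norm (f (- int k - 1)))"
    by (simp_all add: t1 t2)
  have "appell_half x (q ^ 10) = (\<Sum>k. t x k)" for x
    unfolding appell_half_def t_def ..
  then have "appell_half q (q ^ 10) = - (\<Sum>k. f (int k))" "appell_half (q ^ 9) (q ^ 10) = - (\<Sum>k. f (- int k - 1))"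
    using suminf_minus[OF summable_norm_cancel[OF s(1)]] suminf_minus[OF summable_norm_cancel[OF s(2)]]
    by (simp_all add: t1 t2)
  then have "infsum f UNIV = - (appell_half q (q ^ 10) + appell_half (q ^ 9) (q ^ 10))"
    using infsum_int_split[OF s] by simp
  moreover have "gen_fun 1 10 q = 1 / qpoch_inf_list [q ^ 1, q ^ (10 - 1), q ^ 10] (q ^ 10) * infsum f UNIV"
    unfolding gen_fun_def f_def ..
  ultimately show ?thesis
    by (simp add: qpoch_inf_list_def mult_ac)
qed

text \<open>Power series coefficients are determined by the values on the punctured disc, so
  exhibiting one integral expansion there resolves the definite description.\<close>

lemma a_coeff_eqI:
  assumes "\<And>q. q \<noteq> 0 \<Longrightarrow> norm q < 1 \<Longrightarrow> (\<lambda>n. of_int (a n) * q ^ n) sums gen_fun j p q"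
  shows "a_coeff j p = a"
  unfolding a_coeff_def
proof (rule the_equality)
  fix b assume b: "\<forall>q. 0 < norm q \<and> norm q < 1 \<longrightarrow> (\<lambda>n. of_int (b n) * q ^ n) sums gen_fun j p q"
  define c :: "nat \<Rightarrow> complex" where "c = (\<lambda>n. case n of 0 \<Rightarrow> 0 | Suc k \<Rightarrow> of_int (b k) - of_int (a k))"
  txt \<open>The factor \<open>q\<close> makes the difference of the two series vanish at 0 as well.\<close>
  have c_sums: "(\<lambda>n. c n * q ^ n) sums 0" if "norm q < 1" for q
  proof -
    have "(\<lambda>n. q * (of_int (b n) * q ^ n - of_int (a n) * q ^ n)) sums 0"
    proof (cases "q = 0")
      case False
      then show ?thesis
        using sums_mult[OF sums_diff[OF b[rule_format, of q] assms[OF False that]], of q] that by simp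
    qed simp
    then have "(\<lambda>n. c (Suc n) * q ^ Suc n) sums 0"
      by (simp add: c_def algebra_simps)
    from sums_Suc[OF this] show ?thesis by (simp add: c_def)
  qed
  show "b = a"
  proof
    fix n
    have "c (Suc n) = 0"
      using taylor_coeff_of_sums[OF c_sums, of "Suc n"] taylor_coeff_of_sums[of "\<lambda>_. 0" "\<lambda>_. 0" "Suc n"]
      by simp
    then show "b n = a n" by (simp add: c_def)
  qed
qed (use assms in auto)

section \<open>Comparison of odd coefficients and the induction modulo 5\<close>

theorem mainTheorem4:
  fixes n :: nat
  shows "[a_coeff 1 10 (10 * n + 5) = 0] (mod 5)"
proof -
  \<comment> \<open>Off 0, \<open>A\<close> is the generating function; in the notation of the
    overview, \<open>E\<close> is \<open>J^3\<close> and \<open>L\<close> is the Lambert series at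
    \<open>z = q\<close>.\<close>
  define S where "S = (\<lambda>q. - (appell_half q (q ^ 10) + appell_half (q ^ 9) (q ^ 10)))"
  define D where "D = (\<lambda>q. qpoch_inf q (q ^ 10) * qpoch_inf (q ^ 9) (q ^ 10) * qpoch_inf (q ^ 10) (q ^ 10))"
  define E where "E = (\<lambda>q. qpoch_inf (q ^ 10) (q ^ 10) ^ 3)"
  define L where "L = (\<lambda>q. lambert_half q (q ^ 10) + lambert_half (q ^ 9) (q ^ 10))"
  define A where "A = (\<lambda>q. S q / D q)"
  note qpoch_inf_Ints = taylor_in_qpoch_inf[where d = 1, simplified, folded Ints_def]

  have S: "taylor_in (\<lambda>_. \<int>) S"
  proof -
    have "taylor_in (\<lambda>_. \<int>) (\<lambda>q. ((- 1) * q ^ 0) * (appell_half (q ^ 1) (q ^ 10) + appell_half (q ^ 9) (q ^ 10)))"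
      by (intro taylor_in_mult taylor_in_add taylor_in_appell_half taylor_in_monomial) auto
    then show ?thesis by (simp add: S_def)
  qed
  have D: "taylor_in (\<lambda>_. \<int>) D"
  proof -
    have "taylor_in (\<lambda>_. \<int>) (\<lambda>q. qpoch_inf (q ^ 1) (q ^ 10) * qpoch_inf (q ^ 9) (q ^ 10) * qpoch_inf (q ^ 10) (q ^ 10))"
      by (intro taylor_in_mult qpoch_inf_Ints) auto
    then show ?thesis by (simp add: D_def)
  qed
  have E: "taylor_in (\<lambda>n. of_int ` {k. 10 dvd n \<or> k = 0}) E" (is "taylor_in ?X _")
  proof -
    have "taylor_in ?X (\<lambda>q. \<Prod>i<(3::nat). qpoch_inf (q ^ 10) (q ^ 10))"
    proof (rule taylor_in_prod)
      show "taylor_in ?X (\<lambda>q. qpoch_inf (q ^ 10) (q ^ 10))"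
        by (rule taylor_in_qpoch_inf) (auto simp: dvd_add)
      show "x + y \<in> ?X n" if "x \<in> ?X n" "y \<in> ?X n" for x y :: complex and n
        using that by (rule of_int_image_add) auto
      show "x * y \<in> ?X (m + n)" if "x \<in> ?X m" "y \<in> ?X n" for x y :: complex and m n
        using that by (rule of_int_image_mult) auto
    qed (auto intro: image_eqI[of _ _ 0] image_eqI[of _ _ 1])
    then show ?thesis by (simp add: E_def)
  qed
  have L: "taylor_in (\<lambda>n. of_int ` {k. 5 dvd n \<longrightarrow> 5 dvd k}) L" (is "taylor_in ?Y _")
  proof -
    have cop: "coprime (a + 10 * m) 5" if "a \<in> {1, 9}" for a m :: nat
    proof -
      have "a = 1 \<or> a = 9" using that by auto
      then have "\<not> 5 dvd a + 10 * m" by presburger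
      then show ?thesis by (simp add: prime_imp_coprime coprime_commute[of _ 5])
    qed
    have "taylor_in ?Y (\<lambda>q. lambert_half (q ^ 1) (q ^ 10) + lambert_half (q ^ 9) (q ^ 10))"
    proof (rule taylor_in_add)
      show "taylor_in ?Y (\<lambda>q. lambert_half (q ^ 1) (q ^ 10))" "taylor_in ?Y (\<lambda>q. lambert_half (q ^ 9) (q ^ 10))"
        using taylor_in_lambert_half[OF _ _ cop[of 1]] taylor_in_lambert_half[OF _ _ cop[of 9]]
        by (simp_all del: power_one_right)
      show "x + y \<in> ?Y n" if "x \<in> ?Y n" "y \<in> ?Y n" for x y :: complex and n
        using that by (rule of_int_image_add) auto
    qed
    then show ?thesis by (simp add: L_def)
  qed
  have hol: "S holomorphic_on ball 0 1" "D holomorphic_on ball 0 1" "E holomorphic_on ball 0 1"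
    "L holomorphic_on ball 0 1"
    using S D E L by (auto simp: taylor_in_def)
  have small: "norm (q ^ 9) < 1" "norm (q ^ 10) < 1" if "norm q < 1" for q :: complex
    by (rule norm_power_less_one; use that in simp)+
  have D_nz: "D q \<noteq> 0" if "norm q < 1" for q
    using that small[OF that] by (simp add: D_def qpoch_inf_nonzero del: norm_power)
  have A_hol: "A holomorphic_on ball 0 1"
    unfolding A_def by (intro holomorphic_intros hol) (use D_nz in auto)
  have A: "taylor_in (\<lambda>_. \<int>) A"
  proof (rule taylor_in_Ints_divide[OF D _ S A_hol])
    show "D 0 = 1" by (simp add: D_def qpoch_inf_def)
  qed (use D_nz in \<open>auto simp: A_def\<close>)
  have "\<exists>k. taylor_coeff A i = of_int k" for i
    using A by (auto simp: taylor_in_def elim: Ints_cases)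
  then obtain a where a: "\<And>i. taylor_coeff A i = of_int (a i)"
    by metis
  have "gen_fun 1 10 q = A q" if "q \<noteq> 0" "norm q < 1" for q
    unfolding gen_fun_1_10[OF that] A_def S_def D_def ..
  then have "a_coeff 1 10 = a"
    using taylor_coeff_sums[OF A_hol] unfolding a by (intro a_coeff_eqI) metis

  \<comment> \<open>With \<open>Q = q ^ 10\<close> held fixed, \<open>L - E * A\<close> is the
    function \<open>h\<close> of \<open>appell_theta_constant\<close> at \<open>z = q\<close>. The
    point \<open>z = - q\<close> has the same tenth power, so constancy of \<open>h\<close> gives
    evenness.\<close>
  have even: "L (- q) - E (- q) * A (- q) = L q - E q * A q" if "norm q < 1" for q
  proof (cases "q = 0")
    case False
    define h where "h = (\<lambda>z. (qpoch_inf (q ^ 10) (q ^ 10))\<^sup>2 * (appell_half z (q ^ 10) + appell_half (q ^ 10 / z) (q ^ 10))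
     / (qpoch_inf z (q ^ 10) * qpoch_inf (q ^ 10 / z) (q ^ 10)) + lambert_half z (q ^ 10) + lambert_half (q ^ 10 / z) (q ^ 10))"
    have h: "L w - E w * A w = h w" if "w \<noteq> 0" "w ^ 10 = q ^ 10" "norm w < 1" for w
    proof -
      have "w ^ 10 / w = w ^ 9" using that by (simp add: field_simps flip: power_Suc)
      moreover have "qpoch_inf (w ^ 10) (w ^ 10) \<noteq> 0"
        using small[OF that(3)] by (intro qpoch_inf_nonzero)
      ultimately show ?thesis
        unfolding h_def L_def E_def A_def S_def D_def that(2)[symmetric]
        by (simp add: power2_eq_square power3_eq_cube)
          (simp add: algebra_simps add_divide_distrib diff_divide_distrib)
    qed
    have "norm q * norm (q ^ 9) < norm q * 1"
      using small[OF that] False by (intro mult_strict_left_mono) auto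
    then have "norm (q ^ 10) < norm q" by (simp add: norm_power flip: power_Suc)
    then have "h (- q) = h q"
      unfolding h_def using that False by (intro appell_theta_constant) auto
    then show ?thesis using h[of q] h[of "- q"] that False by simp
  qed simp
  have EA_hol: "(\<lambda>q. E q * A q) holomorphic_on ball 0 1"
    by (intro holomorphic_on_mult hol A_hol)
  have conv: "(\<Sum>i=0..m. taylor_coeff E i * taylor_coeff A (m - i)) = taylor_coeff L m" if "odd m" for m
  proof -
    have "taylor_coeff (\<lambda>q. L q - E q * A q) m = 0"
      using even \<open>odd m\<close> by (intro taylor_coeff_even_function holomorphic_on_diff hol EA_hol)
    then show ?thesis
      using taylor_coeff_diff[OF hol(4) EA_hol] taylor_coeff_mult[OF hol(3) A_hol] by simp
  qed
  have "\<exists>e. taylor_coeff E i = of_int e \<and> (10 dvd i \<or> e = 0)" for i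
    using E by (auto simp: taylor_in_def)
  then obtain e where e: "\<And>i. taylor_coeff E i = of_int (e i)" "\<And>i. 10 dvd i \<or> e i = 0"
    by metis
  have "taylor_coeff E 0 = 1"
    by (simp add: taylor_coeff_def E_def qpoch_inf_def)
  then have e0: "e 0 = 1" using e(1)[of 0] by simp
  have "\<exists>l. taylor_coeff L i = of_int l \<and> (5 dvd i \<longrightarrow> 5 dvd l)" for i
    using L by (auto simp: taylor_in_def)
  then obtain l where l: "\<And>i. taylor_coeff L i = of_int (l i)" "\<And>i. 5 dvd i \<Longrightarrow> 5 dvd l i"
    by metis
  have "(5::int) dvd a (10 * n + 5)"
  proof (induction n rule: less_induct)
    case (less n)
    \<comment> \<open>The index is odd, so \<open>conv\<close> applies, and a multiple of 5, so
      \<open>5 dvd l m\<close>.\<close>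
    define m where "m = 10 * n + 5"
    have "of_int (\<Sum>i=0..m. e i * a (m - i)) = (of_int (l m) :: complex)"
      using conv[of m] by (simp add: e(1) l(1) a m_def)
    then have "(\<Sum>i=0..m. e i * a (m - i)) = l m" by (rule of_int_eq_iff[THEN iffD1])
    moreover have "(\<Sum>i=0..m. e i * a (m - i)) = a m + (\<Sum>i=1..m. e i * a (m - i))"
      using e0 by (subst sum.atLeast_Suc_atMost) auto
    moreover have "5 dvd (\<Sum>i=1..m. e i * a (m - i))"
    proof (rule dvd_sum)
      fix i assume i: "i \<in> {1..m}"
      show "5 dvd e i * a (m - i)"
      \<comment> \<open>For \<open>i = 10 * k\<close> with \<open>k > 0\<close> the index
        \<open>m - i\<close> is again 5 modulo 10 and smaller, so the induction hypothesis applies;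
        for all other \<open>i\<close> the factor \<open>e i\<close> is 0.\<close>
      proof (cases "10 dvd i")
        case True
        then obtain k where k: "i = 10 * k" by auto
        with i have "m - i = 10 * (n - k) + 5" "n - k < n" by (auto simp: m_def)
        with less[of "n - k"] show ?thesis by simp
      qed (use e(2)[of i] in auto)
    qed
    moreover have "5 dvd l m" by (rule l(2)) (simp add: m_def)
    ultimately show ?case by (metis dvd_add_left_iff m_def)
  qed
  then show ?thesis using \<open>a_coeff 1 10 = a\<close> by (simp add: cong_0_iff)
qed

end
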